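(* Let $S$ be the facial monoid and let $T$ be the free abelian monoid on the set $\mathbf{N}$ (or, alternatively, the free abelian group $\mathbf{Z}[\mathbf{N}]$), with the right $S$-action on $T$ described in the context. Then the right semi-direct product $S\ltimes T$ is amenable.
   Context: $\mathbf{N}=\{1,2,\ldots\}$. The facial monoid is given by the monoid presentation $S=\langle s_i\ (i\in\mathbf{N}) : s_js_i=s_is_{j+1}\ \forall\,1\leq i\leq j\rangle$. Elements of $T$ are written $t=(t_n)_{n\in\mathbf{N}}$ with $t_n$ integers (non-negative in the case of the free abelian monoid), all but finitely many zero, with addition as operation. The right action of $S$ on $T$ by endomorphisms, denoted $t^s$, is determined by $$(t^{s_i})_n=\begin{cases} t_n & \text{if } n\leq i,\\ 0 & \text{if } n=i+1,\\ t_{n-1} & \text{if } n\geq i+2.\end{cases}$$ The right semi-direct product $S\ltimes T$ is the product set $S\times T$ with the associative multiplication $(s,t)(s',t')=(ss',\,t^{s'}\,t')$ (where the operation of $T$, here addition, is written multiplicatively). Amenability of a monoid $M$: every non-empty convex compact $M$-space has a fixed point, where a convex compact $M$-space is a convex compact set $K$ in a Hausdorff topological vector space $V$ together with an $M$-action on $V$ by continuous affine transformations preserving $K$. By a theorem of Day this is equivalent to the existence of a left-invariant mean on $M$, i.e. a positive normalized linear functional $m$ on $\ell^\infty(M)$ with $m(x\mapsto f(sx))=m(f)$ for all $f\in\ell^\infty(M)$ and $s\in M$. *)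

theory Defs
  imports "HOL-Analysis.Analysis" "HOL-Algebra.Free_Abelian_Groups"
begin

section \<open>Monoids given by generators and relations\<close>

inductive_set presentation_cong :: "'a set \<Rightarrow> ('a list \<times> 'a list) set \<Rightarrow> ('a list \<times> 'a list) set"
  for A :: "'a set" and R :: "('a list \<times> 'a list) set"
where
  relation: "(u, v) \<in> R \<Longrightarrow> u \<in> lists A \<Longrightarrow> v \<in> lists A \<Longrightarrow> x \<in> lists A \<Longrightarrow> y \<in> lists A
    \<Longrightarrow> (x @ u @ y, x @ v @ y) \<in> presentation_cong A R"
| refl: "x \<in> lists A \<Longrightarrow> (x, x) \<in> presentation_cong A R"
| sym: "(x, y) \<in> presentation_cong A R \<Longrightarrow> (y, x) \<in> presentation_cong A R"
| trans: "(x, y) \<in> presentation_cong A R \<Longrightarrow> (y, z) \<in> presentation_cong A R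
    \<Longrightarrow> (x, z) \<in> presentation_cong A R"

definition presented_monoid :: "'a set \<Rightarrow> ('a list \<times> 'a list) set \<Rightarrow> 'a list set monoid" where
  "presented_monoid A R =
    \<lparr>carrier = lists A // presentation_cong A R,
     monoid.mult = (\<lambda>X Y. \<Union>x\<in>X. \<Union>y\<in>Y. presentation_cong A R `` {x @ y}),
     one = presentation_cong A R `` {[]}\<rparr>"

lemma presentation_cong_lists:
  "(x, y) \<in> presentation_cong A R \<Longrightarrow> x \<in> lists A \<and> y \<in> lists A"
  by (induction rule: presentation_cong.induct) auto

lemma equiv_presentation_cong: "equiv (lists A) (presentation_cong A R)"
proof (rule equivI)
  show "presentation_cong A R \<subseteq> lists A \<times> lists A"
    using presentation_cong_lists by fast
  show "refl_on (lists A) (presentation_cong A R)"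
    by (rule refl_onI) (rule presentation_cong.refl)
  show "sym_on UNIV (presentation_cong A R)"
    by (rule symI) (rule presentation_cong.sym)
  show "trans_on UNIV (presentation_cong A R)"
    by (rule transI) (rule presentation_cong.trans)
qed

lemma presentation_cong_append_right:
  "(x, y) \<in> presentation_cong A R \<Longrightarrow> z \<in> lists A \<Longrightarrow> (x @ z, y @ z) \<in> presentation_cong A R"
proof (induction rule: presentation_cong.induct)
  case (relation u v x y)
  then have "y @ z \<in> lists A" by simp
  from presentation_cong.relation[OF relation(1-4) this] show ?case by simp
next
  case (refl x)
  then show ?case by (simp add: presentation_cong.refl)
next
  case (sym x y)
  then show ?case by (simp add: presentation_cong.sym)
next
  case (trans x y w)
  then show ?case using presentation_cong.trans by metis
qed

lemma presentation_cong_append_left: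
  "(x, y) \<in> presentation_cong A R \<Longrightarrow> z \<in> lists A \<Longrightarrow> (z @ x, z @ y) \<in> presentation_cong A R"
proof (induction rule: presentation_cong.induct)
  case (relation u v x y)
  then have "z @ x \<in> lists A" by simp
  from presentation_cong.relation[OF relation(1-3) this relation(5)] show ?case by simp
next
  case (refl x)
  then show ?case by (simp add: presentation_cong.refl)
next
  case (sym x y)
  then show ?case by (simp add: presentation_cong.sym)
next
  case (trans x y w)
  then show ?case using presentation_cong.trans by metis
qed

lemma presented_monoid_mult_class:
  assumes "x \<in> lists A" "y \<in> lists A"
  shows "presentation_cong A R `` {x} \<otimes>\<^bsub>presented_monoid A R\<^esub> presentation_cong A R `` {y}
    = presentation_cong A R `` {x @ y}"
proof -
  let ?C = "presentation_cong A R"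
  have "?C `` {x' @ y'} = ?C `` {x @ y}" if "(x, x') \<in> ?C" "(y, y') \<in> ?C" for x' y'
  proof -
    have "(x @ y, x' @ y) \<in> ?C"
      using presentation_cong_append_right that(1) assms(2) by blast
    moreover have "(x' @ y, x' @ y') \<in> ?C"
      using presentation_cong_append_left[OF that(2)] presentation_cong_lists[OF that(1)] by blast
    ultimately have "(x @ y, x' @ y') \<in> ?C"
      by (rule presentation_cong.trans)
    then show ?thesis
      using equiv_class_eq[OF equiv_presentation_cong] by metis
  qed
  moreover have "(x, x) \<in> ?C" "(y, y) \<in> ?C"
    using assms by (auto intro: presentation_cong.refl)
  ultimately have "(\<Union>x'\<in>?C `` {x}. \<Union>y'\<in>?C `` {y}. ?C `` {x' @ y'}) = ?C `` {x @ y}"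
    by blast
  then show ?thesis
    by (simp add: presented_monoid_def)
qed

lemma monoid_presented_monoid: "monoid (presented_monoid A R)"
proof -
  let ?M = "presented_monoid A R" and ?C = "presentation_cong A R"
  have carr: "\<exists>x\<in>lists A. X = ?C `` {x}" if "X \<in> carrier ?M" for X
    using that by (auto simp: presented_monoid_def elim: quotientE)
  have cls: "?C `` {x} \<in> carrier ?M" if "x \<in> lists A" for x
    using that by (auto simp: presented_monoid_def intro: quotientI)
  have one: "\<one>\<^bsub>?M\<^esub> = ?C `` {[]}"
    by (simp add: presented_monoid_def)
  note mult = presented_monoid_mult_class[of _ A _ R]
  show ?thesis
  proof (rule monoidI)
    fix X Y assume "X \<in> carrier ?M" "Y \<in> carrier ?M"
    then obtain x y where xy: "x \<in> lists A" "y \<in> lists A" "X = ?C `` {x}" "Y = ?C `` {y}"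
      using carr by meson
    then show "X \<otimes>\<^bsub>?M\<^esub> Y \<in> carrier ?M" using cls[of "x @ y"] mult[of x y] by simp
  next
    show "\<one>\<^bsub>?M\<^esub> \<in> carrier ?M" using cls[of "[]"] one by simp
  next
    fix X Y Z assume "X \<in> carrier ?M" "Y \<in> carrier ?M" "Z \<in> carrier ?M"
    then obtain x y z where xy: "x \<in> lists A" "y \<in> lists A" "z \<in> lists A"
      and XY: "X = ?C `` {x}" "Y = ?C `` {y}" "Z = ?C `` {z}"
      using carr by meson
    have "x @ y \<in> lists A" "y @ z \<in> lists A" using xy by auto
    then show "X \<otimes>\<^bsub>?M\<^esub> Y \<otimes>\<^bsub>?M\<^esub> Z = X \<otimes>\<^bsub>?M\<^esub> (Y \<otimes>\<^bsub>?M\<^esub> Z)"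
      unfolding XY using xy by (simp only: mult append_assoc)
  next
    fix X assume "X \<in> carrier ?M"
    then obtain x where x: "x \<in> lists A" "X = ?C `` {x}"
      using carr by meson
    have nil: "[] \<in> lists A" by simp
    show "\<one>\<^bsub>?M\<^esub> \<otimes>\<^bsub>?M\<^esub> X = X" "X \<otimes>\<^bsub>?M\<^esub> \<one>\<^bsub>?M\<^esub> = X"
      using mult[OF nil x(1)] mult[OF x(1) nil] by (simp_all add: one x)
  qed
qed


section \<open>The facial monoid and its action on the free abelian group\<close>

definition posnats :: "nat set" where
  "posnats = {1..}"

lemma mem_posnats [simp]: "n \<in> posnats \<longleftrightarrow> 1 \<le> n"
  by (simp add: posnats_def)

definition facial_relations :: "(nat list \<times> nat list) set" where
  "facial_relations = {([j, i], [i, j + 1]) | i j. 1 \<le> i \<and> i \<le> j}"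

definition facial_monoid :: "nat list set monoid" where
  "facial_monoid = presented_monoid posnats facial_relations"

definition facial_class :: "nat list \<Rightarrow> nat list set" where
  "facial_class w = presentation_cong posnats facial_relations `` {w}"

text \<open>The class \<^term>\<open>facial_class [i]\<close> is the generator written $s_i$.\<close>

definition free_abelian_monoid :: "'a set \<Rightarrow> ('a \<Rightarrow>\<^sub>0 int) monoid" where
  "free_abelian_monoid A =
    \<lparr>carrier = {t \<in> carrier (free_Abelian_group A). \<forall>n. 0 \<le> Poly_Mapping.lookup t n},
     monoid.mult = (+), one = 0\<rparr>"

text \<open>Sequences indexed by the positive integers are represented by finitely supported functions
  on \<^typ>\<open>nat\<close> vanishing at \<open>0\<close>.\<close>

lift_definition insert_zero :: "nat \<Rightarrow> (nat \<Rightarrow>\<^sub>0 int) \<Rightarrow> (nat \<Rightarrow>\<^sub>0 int)"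
  is "\<lambda>i t n. if n \<le> i then t n else if n = i + 1 then 0 else t (n - 1)"
proof -
  fix i :: nat and t :: "nat \<Rightarrow> int"
  assume fin: "finite {n. t n \<noteq> 0}"
  have "{n. (if n \<le> i then t n else if n = i + 1 then 0 else t (n - 1)) \<noteq> 0}
      \<subseteq> {n. t n \<noteq> 0} \<union> Suc ` {n. t n \<noteq> 0}"
  proof
    fix n assume "n \<in> {n. (if n \<le> i then t n else if n = i + 1 then 0 else t (n - 1)) \<noteq> 0}"
    then show "n \<in> {n. t n \<noteq> 0} \<union> Suc ` {n. t n \<noteq> 0}"
      by (cases n) (auto split: if_splits)
  qed
  then show "finite {n. (if n \<le> i then t n else if n = i + 1 then 0 else t (n - 1)) \<noteq> 0}"
    by (rule finite_subset) (use fin in auto)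
qed

text \<open>The action of a word does not depend on the representative of its class in the facial
  monoid, see \<open>facial_act_class\<close> below. As this is a right action, the leftmost letter of the
  word acts first.\<close>

definition facial_act :: "(nat \<Rightarrow>\<^sub>0 int) \<Rightarrow> nat list set \<Rightarrow> (nat \<Rightarrow>\<^sub>0 int)" where
  "facial_act t s = the_elem ((\<lambda>w. fold insert_zero w t) ` s)"

lemma insert_zero_commute:
  assumes "i \<le> j"
  shows "insert_zero i (insert_zero j t) = insert_zero (Suc j) (insert_zero i t)"
  using assms by transfer (auto simp: fun_eq_iff)

lemma facial_cong_fold:
  "(v, w) \<in> presentation_cong posnats facial_relations
    \<Longrightarrow> fold insert_zero v t = fold insert_zero w t"
proof (induction arbitrary: t rule: presentation_cong.induct)
  case (relation u v x y)
  then show ?case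
    by (auto simp: facial_relations_def insert_zero_commute)
qed auto

lemma facial_act_class:
  assumes "w \<in> lists posnats"
  shows "facial_act t (facial_class w) = fold insert_zero w t"
proof -
  have "w \<in> facial_class w"
    using assms by (simp add: facial_class_def presentation_cong.refl)
  moreover have "fold insert_zero v t = fold insert_zero w t" if "v \<in> facial_class w" for v
    using facial_cong_fold[of w v t] that by (simp add: facial_class_def)
  ultimately have "(\<lambda>v. fold insert_zero v t) ` facial_class w = {fold insert_zero w t}"
    by blast
  then show ?thesis
    by (simp add: facial_act_def)
qed

lemma facial_act_generator:
  assumes "1 \<le> i"
  shows "Poly_Mapping.lookup (facial_act t (facial_class [i])) n =
    (if n \<le> i then Poly_Mapping.lookup t n else if n = i + 1 then 0
     else Poly_Mapping.lookup t (n - 1))"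
  using assms by (simp add: facial_act_class insert_zero.rep_eq)

lemma facial_carrierE:
  assumes "s \<in> carrier facial_monoid"
  obtains w where "w \<in> lists posnats" "s = facial_class w"
proof -
  have "s \<in> lists posnats // presentation_cong posnats facial_relations"
    using assms by (simp add: facial_monoid_def presented_monoid_def)
  then show thesis
    by (rule quotientE) (use that in \<open>simp add: facial_class_def\<close>)
qed

lemma facial_class_mult:
  "v \<in> lists posnats \<Longrightarrow> w \<in> lists posnats
    \<Longrightarrow> facial_class v \<otimes>\<^bsub>facial_monoid\<^esub> facial_class w = facial_class (v @ w)"
  unfolding facial_monoid_def facial_class_def by (rule presented_monoid_mult_class)

lemma facial_generators_relation:
  assumes "1 \<le> i" "i \<le> j"
  shows "facial_class [j] \<otimes>\<^bsub>facial_monoid\<^esub> facial_class [i] =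
    facial_class [i] \<otimes>\<^bsub>facial_monoid\<^esub> facial_class [j + 1]"
proof -
  have "([j, i], [i, j + 1]) \<in> presentation_cong posnats facial_relations"
    using presentation_cong.relation[of "[j, i]" "[i, j + 1]" facial_relations posnats "[]" "[]"]
      assms by (auto simp: facial_relations_def)
  then have "facial_class [j, i] = facial_class [i, j + 1]"
    unfolding facial_class_def by (rule equiv_class_eq[OF equiv_presentation_cong])
  then show ?thesis
    using assms by (simp add: facial_class_mult)
qed

lemma facial_act_one: "facial_act t \<one>\<^bsub>facial_monoid\<^esub> = t"
  using facial_act_class[of "[]" t]
  by (simp add: facial_monoid_def presented_monoid_def facial_class_def)

lemma facial_act_mult:
  assumes "r \<in> carrier facial_monoid" "s \<in> carrier facial_monoid"
  shows "facial_act t (r \<otimes>\<^bsub>facial_monoid\<^esub> s) = facial_act (facial_act t r) s"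
  using assms
  by (elim facial_carrierE)
    (simp add: facial_class_mult facial_act_class)

lemma facial_act_add:
  assumes "s \<in> carrier facial_monoid"
  shows "facial_act (t + u) s = facial_act t s + facial_act u s"
proof -
  have [simp]: "insert_zero i (t + u) = insert_zero i t + insert_zero i u" for i t u
    by transfer (auto simp: fun_eq_iff)
  have "fold insert_zero w (t + u) = fold insert_zero w t + fold insert_zero w u" for w
    by (induction w arbitrary: t u) auto
  with assms show ?thesis
    by (elim facial_carrierE) (simp add: facial_act_class)
qed

lemma facial_act_zero:
  assumes "s \<in> carrier facial_monoid"
  shows "facial_act 0 s = 0"
  using facial_act_add[OF assms, of 0 0] by simp

lemma insert_zero_closed:
  assumes "1 \<le> i"
  shows "t \<in> carrier (free_Abelian_group posnats)
      \<Longrightarrow> insert_zero i t \<in> carrier (free_Abelian_group posnats)"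
    and "t \<in> carrier (free_abelian_monoid posnats)
      \<Longrightarrow> insert_zero i t \<in> carrier (free_abelian_monoid posnats)"
proof -
  have iff: "Poly_Mapping.keys t \<subseteq> posnats \<longleftrightarrow> Poly_Mapping.lookup t 0 = 0" for t :: "nat \<Rightarrow>\<^sub>0 int"
  proof
    assume "Poly_Mapping.keys t \<subseteq> posnats"
    then have "0 \<notin> Poly_Mapping.keys t" by auto
    then show "Poly_Mapping.lookup t 0 = 0" by (simp add: in_keys_iff)
  next
    assume "Poly_Mapping.lookup t 0 = 0"
    then have "n \<noteq> 0" if "n \<in> Poly_Mapping.keys t" for n
      using that by (metis in_keys_iff)
    then show "Poly_Mapping.keys t \<subseteq> posnats" by (auto simp: Suc_le_eq)
  qed
  show "t \<in> carrier (free_Abelian_group posnats)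
      \<Longrightarrow> insert_zero i t \<in> carrier (free_Abelian_group posnats)"
    "t \<in> carrier (free_abelian_monoid posnats)
      \<Longrightarrow> insert_zero i t \<in> carrier (free_abelian_monoid posnats)"
    by (auto simp: free_abelian_monoid_def iff insert_zero.rep_eq)
qed

lemma facial_act_closed:
  assumes "s \<in> carrier facial_monoid"
  shows "t \<in> carrier (free_Abelian_group posnats)
      \<Longrightarrow> facial_act t s \<in> carrier (free_Abelian_group posnats)"
    and "t \<in> carrier (free_abelian_monoid posnats)
      \<Longrightarrow> facial_act t s \<in> carrier (free_abelian_monoid posnats)"
proof -
  obtain w where w: "w \<in> lists posnats" "s = facial_class w"
    using assms by (rule facial_carrierE)
  have "t \<in> carrier (free_Abelian_group posnats)
      \<Longrightarrow> fold insert_zero w t \<in> carrier (free_Abelian_group posnats)"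
    "t \<in> carrier (free_abelian_monoid posnats)
      \<Longrightarrow> fold insert_zero w t \<in> carrier (free_abelian_monoid posnats)" for t
    using w(1) by (induction w arbitrary: t)
      (auto simp del: carrier_free_Abelian_group_iff simp: insert_zero_closed)
  with w show "t \<in> carrier (free_Abelian_group posnats)
      \<Longrightarrow> facial_act t s \<in> carrier (free_Abelian_group posnats)"
    "t \<in> carrier (free_abelian_monoid posnats)
      \<Longrightarrow> facial_act t s \<in> carrier (free_abelian_monoid posnats)"
    by (simp_all only: facial_act_class)
qed


section \<open>Right semi-direct products\<close>

definition right_semidirect ::
  "('s, 'm) monoid_scheme \<Rightarrow> ('t, 'n) monoid_scheme \<Rightarrow> ('t \<Rightarrow> 's \<Rightarrow> 't) \<Rightarrow> ('s \<times> 't) monoid" where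
  "right_semidirect S T act =
    \<lparr>carrier = carrier S \<times> carrier T,
     monoid.mult = (\<lambda>(s, t) (s', t'). (s \<otimes>\<^bsub>S\<^esub> s', act t s' \<otimes>\<^bsub>T\<^esub> t')),
     one = (\<one>\<^bsub>S\<^esub>, \<one>\<^bsub>T\<^esub>)\<rparr>"

lemma monoid_right_semidirect:
  assumes "monoid S" "monoid T"
    and closed: "\<And>s t. s \<in> carrier S \<Longrightarrow> t \<in> carrier T \<Longrightarrow> act t s \<in> carrier T"
    and "\<And>t. t \<in> carrier T \<Longrightarrow> act t \<one>\<^bsub>S\<^esub> = t"
    and "\<And>r s t. r \<in> carrier S \<Longrightarrow> s \<in> carrier S \<Longrightarrow> t \<in> carrier T
      \<Longrightarrow> act t (r \<otimes>\<^bsub>S\<^esub> s) = act (act t r) s"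
    and "\<And>s. s \<in> carrier S \<Longrightarrow> act \<one>\<^bsub>T\<^esub> s = \<one>\<^bsub>T\<^esub>"
    and "\<And>s t u. s \<in> carrier S \<Longrightarrow> t \<in> carrier T \<Longrightarrow> u \<in> carrier T
      \<Longrightarrow> act (t \<otimes>\<^bsub>T\<^esub> u) s = act t s \<otimes>\<^bsub>T\<^esub> act u s"
  shows "monoid (right_semidirect S T act)"
proof -
  interpret S: monoid S by fact
  interpret T: monoid T by fact
  show ?thesis
    by (rule monoidI) (auto simp: right_semidirect_def assms S.m_assoc T.m_assoc)
qed

lemma monoid_free_abelian_monoid: "monoid (free_abelian_monoid A)"
  by (rule monoidI)
    (auto simp: free_abelian_monoid_def lookup_add add.assoc dest: subsetD[OF keys_add])

lemma monoid_facial_semidirect: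
  "monoid (right_semidirect facial_monoid (free_abelian_monoid posnats) facial_act)"
  "monoid (right_semidirect facial_monoid (free_Abelian_group posnats) facial_act)"
proof -
  have S: "monoid facial_monoid"
    unfolding facial_monoid_def by (rule monoid_presented_monoid)
  have "monoid (free_Abelian_group posnats)"
    using group_free_Abelian_group by (rule group.is_monoid)
  then show "monoid (right_semidirect facial_monoid (free_Abelian_group posnats) facial_act)"
    using S facial_act_closed(1)
    by (intro monoid_right_semidirect)
      (simp_all add: facial_act_one facial_act_mult facial_act_zero facial_act_add)
  have [simp]: "\<one>\<^bsub>free_abelian_monoid posnats\<^esub> = 0"
    "t \<otimes>\<^bsub>free_abelian_monoid posnats\<^esub> u = t + u" for t u
    by (simp_all add: free_abelian_monoid_def)
  from S monoid_free_abelian_monoid[of posnats]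
  show "monoid (right_semidirect facial_monoid (free_abelian_monoid posnats) facial_act)"
    using facial_act_closed(2)
    by (intro monoid_right_semidirect)
      (simp_all add: facial_act_one facial_act_mult facial_act_zero facial_act_add)
qed


section \<open>Amenability\<close>

class topological_real_vector = real_vector + topological_ab_group_add +
  assumes tendsto_scaleR_Pair:
    "LIM x (nhds c \<times>\<^sub>F nhds a). fst x *\<^sub>R snd x :> nhds (c *\<^sub>R a)"

instance real_normed_vector \<subseteq> topological_real_vector
proof
  fix c :: real and a :: 'a
  have "(fst \<longlongrightarrow> c) (nhds c \<times>\<^sub>F nhds a)" "(snd \<longlongrightarrow> a) (nhds c \<times>\<^sub>F nhds a)"
    by (rule filterlim_fst filterlim_snd)+
  then show "LIM x (nhds c \<times>\<^sub>F nhds a). fst x *\<^sub>R snd x :> nhds (c *\<^sub>R a)"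
    by (rule tendsto_scaleR)
qed

definition affine_transformation :: "('v::real_vector \<Rightarrow> 'v) \<Rightarrow> bool" where
  "affine_transformation f \<longleftrightarrow>
    (\<forall>x y u. f ((1 - u) *\<^sub>R x + u *\<^sub>R y) = (1 - u) *\<^sub>R f x + u *\<^sub>R f y)"

definition convex_compact_space ::
  "('m, 'b) monoid_scheme \<Rightarrow> ('m \<Rightarrow> 'v \<Rightarrow> 'v::{topological_real_vector, t2_space}) \<Rightarrow> 'v set \<Rightarrow> bool"
where
  "convex_compact_space M \<alpha> K \<longleftrightarrow>
    convex K \<and> compact K \<and>
    (\<forall>x. \<alpha> \<one>\<^bsub>M\<^esub> x = x) \<and>
    (\<forall>g\<in>carrier M. \<forall>h\<in>carrier M. \<forall>x. \<alpha> (g \<otimes>\<^bsub>M\<^esub> h) x = \<alpha> g (\<alpha> h x)) \<and>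
    (\<forall>g\<in>carrier M. affine_transformation (\<alpha> g) \<and> continuous_on UNIV (\<alpha> g) \<and> \<alpha> g ` K \<subseteq> K)"

text \<open>HOL cannot quantify over all topological vector spaces inside a formula, so the ambient space
  is a type argument. A monoid \<open>M\<close> is amenable iff \<open>amenable TYPE('v) M\<close> holds for every Hausdorff
  topological vector space \<open>'v\<close>; a theorem with conclusion \<open>amenable TYPE('v) M\<close> and \<open>'v\<close> a type
  variable asserts precisely this.\<close>

definition amenable ::
  "'v::{topological_real_vector, t2_space} itself \<Rightarrow> ('m, 'b) monoid_scheme \<Rightarrow> bool" where
  "amenable _ M \<longleftrightarrow>
    (\<forall>(\<alpha> :: 'm \<Rightarrow> 'v \<Rightarrow> 'v) K. convex_compact_space M \<alpha> K \<and> K \<noteq> {} \<longrightarrow>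
      (\<exists>x\<in>K. \<forall>g\<in>carrier M. \<alpha> g x = x))"

end

theory Submission
  imports Defs
begin

text \<open>Fixed points of \<open>T\<close> are preserved by \<open>S\<close>, because \<open>t s x = s t\<^sup>s x = s x\<close> whenever \<open>x\<close> is fixed
  by \<open>T\<close>. So it suffices to find a fixed point for the commutative monoid \<open>T\<close>, which is the
  Markov--Kakutani theorem, and one for \<open>S\<close>. For the latter, let \<open>x\<^sub>n = P\<^sub>n \<dots> P\<^sub>0 x\<close>, where \<open>P\<^sub>n\<close> is a
  limit of the Cesaro averages of the powers of the \<open>n\<close>-th generator \<open>s\<^sub>n\<close>. Then \<open>s\<^sub>n x\<^sub>n = x\<^sub>n\<close>, and
  the relation \<open>s\<^sub>i s\<^sub>n\<^sub>+\<^sub>1 = s\<^sub>n s\<^sub>i\<close> gives \<open>s\<^sub>i x\<^sub>n\<^sub>+\<^sub>1 = x\<^sub>n\<close> for all \<open>i \<le> n\<close>. Every \<open>s\<^sub>i\<close> thus eventually acts as a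
  shift on the sequence \<open>x\<close>, and therefore fixes every limit point of its Cesaro averages.\<close>

section \<open>Limits along filters in topological vector spaces\<close>

lemma tendsto_scaleR_topological:
  fixes g :: "'a \<Rightarrow> 'v::topological_real_vector"
  assumes "(f \<longlongrightarrow> c) F" "(g \<longlongrightarrow> a) F"
  shows "((\<lambda>x. f x *\<^sub>R g x) \<longlongrightarrow> c *\<^sub>R a) F"
  using filterlim_compose[OF tendsto_scaleR_Pair filterlim_Pair[OF assms]] by simp

text \<open>The space need not be first countable, so convergent subsequences may not exist. A
  filter below \<open>F\<close> takes their place, much as a subnet does.\<close>

lemma compact_refine_filter:
  assumes "compact K" "F \<noteq> bot" "\<And>n. u n \<in> K"
  obtains x G where "x \<in> K" "G \<le> F" "G \<noteq> bot" "(u \<longlongrightarrow> x) G"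
proof -
  have "filtermap u F \<noteq> bot"
    using assms(2) by (simp add: filtermap_bot_iff)
  moreover have "eventually (\<lambda>y. y \<in> K) (filtermap u F)"
    using assms(3) by (simp add: eventually_filtermap)
  ultimately obtain x where x: "x \<in> K" "inf (nhds x) (filtermap u F) \<noteq> bot"
    using assms(1) unfolding compact_filter by blast
  \<comment> \<open>This is the largest filter below \<open>F\<close> along which \<open>u\<close>
    tends to \<open>x\<close>; it is proper because \<open>x\<close> is a cluster point of
    \<open>u\<close> along \<open>F\<close>.\<close>
  define G where "G = inf F (filtercomap u (nhds x))"
  have "G \<noteq> bot"
  proof
    assume "G = bot"
    then have "eventually (\<lambda>_. False) G" by simp
    then obtain P Q where PQ: "eventually P F" "eventually Q (nhds x)" "\<And>n. P n \<Longrightarrow> \<not> Q (u n)"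
      unfolding G_def eventually_inf eventually_filtercomap by blast
    have "eventually (\<lambda>y. \<not> Q y) (filtermap u F)"
      unfolding eventually_filtermap using PQ(1) by (rule eventually_mono) (rule PQ(3))
    with PQ(2) have "eventually (\<lambda>_. False) (inf (nhds x) (filtermap u F))"
      unfolding eventually_inf by blast
    with x(2) show False by (simp add: trivial_limit_def)
  qed
  moreover have "(u \<longlongrightarrow> x) G"
    unfolding G_def by (rule filterlim_mono[OF filterlim_filtercomap order_refl inf_le2])
  ultimately show thesis
    using that[of x G] x(1) by (simp add: G_def)
qed

text \<open>There is no norm to bound \<open>p\<close>. If the quotients left a neighbourhood
  \<open>U\<close> of 0 infinitely often, \<open>p\<close> would converge along a filter on those
  indices, and joint continuity of scaling would force the quotients into \<open>U\<close>.\<close>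

lemma compact_divide_Suc_tendsto_0:
  fixes p :: "nat \<Rightarrow> 'v::topological_real_vector"
  assumes "compact K" "\<And>n. p n \<in> K"
  shows "(\<lambda>n. inverse (real (Suc n)) *\<^sub>R p n) \<longlonglongrightarrow> 0"
proof (rule topological_tendstoI, rule ccontr)
  let ?q = "\<lambda>n. inverse (real (Suc n)) *\<^sub>R p n"
  fix U :: "'v set"
  assume U: "open U" "0 \<in> U" and nev: "\<not> eventually (\<lambda>n. ?q n \<in> U) sequentially"
  define F where "F = inf sequentially (principal {n. ?q n \<notin> U})"
  have "F \<noteq> bot"
    using nev by (simp add: F_def trivial_limit_def eventually_inf_principal)
  from assms(1) this assms(2) obtain x G
    where "x \<in> K" and G: "G \<le> F" "G \<noteq> bot" "(p \<longlongrightarrow> x) G"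
    by (rule compact_refine_filter)
  have "G \<le> sequentially"
    using G(1) by (simp add: F_def)
  then have "((\<lambda>n. inverse (real (Suc n))) \<longlongrightarrow> 0) G"
    using LIMSEQ_inverse_real_of_nat by (rule tendsto_mono)
  then have "(?q \<longlongrightarrow> 0) G"
    using tendsto_scaleR_topological[OF _ G(3)] by fastforce
  then have "eventually (\<lambda>n. ?q n \<in> U) G"
    using U by (rule topological_tendstoD)
  moreover have "eventually (\<lambda>n. ?q n \<notin> U) G"
    using G(1) by (rule filter_leD) (simp add: F_def eventually_inf_principal)
  ultimately have "eventually (\<lambda>_. False) G"
    by eventually_elim simp
  with G(2) show False by (simp add: trivial_limit_def)
qed

section \<open>Cesaro averages and affine maps\<close>

definition cesaro :: "(nat \<Rightarrow> 'v::real_vector) \<Rightarrow> nat \<Rightarrow> 'v" where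
  "cesaro u N = inverse (real (Suc N)) *\<^sub>R (\<Sum>k\<le>N. u k)"

lemma cesaro_const [simp]: "cesaro (\<lambda>_. x) N = x"
  by (simp add: cesaro_def sum_constant_scaleR del: of_nat_Suc)

lemma cesaro_mem:
  assumes "convex K" "\<And>n. u n \<in> K"
  shows "cesaro u N \<in> K"
proof -
  have "(\<Sum>k\<le>N. inverse (real (Suc N)) *\<^sub>R u k) \<in> K"
    using assms by (intro convex_sum) (auto simp del: of_nat_Suc)
  then show ?thesis
    by (simp add: cesaro_def scaleR_sum_right)
qed

text \<open>Subtracting \<open>f 0\<close> leaves a linear map, which commutes with finite sums; the
  constant returns unchanged because the average of a constant is that constant.\<close>

lemma affine_transformation_cesaro:
  assumes "affine_transformation f"
  shows "f (cesaro u N) = cesaro (\<lambda>k. f (u k)) N"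
proof -
  have aff: "f ((1 - c) *\<^sub>R x + c *\<^sub>R y) = (1 - c) *\<^sub>R f x + c *\<^sub>R f y" for x y c
    using assms by (simp add: affine_transformation_def)
  define g where "g x = f x - f 0" for x
  \<comment> \<open>The weight in \<open>affine_transformation\<close> ranges over all reals, so
    \<open>c\<close> is not confined to the interval from 0 to 1.\<close>
  have scale: "g (c *\<^sub>R x) = c *\<^sub>R g x" for c x
    using aff[of c 0 x] by (simp add: g_def algebra_simps)
  \<comment> \<open>Homogeneity reduces additivity to the midpoint of \<open>x\<close> and
    \<open>y\<close>, after which the factor 1/2 cancels.\<close>
  have "g (x + y) = g x + g y" for x y
  proof -
    have "(1/2::real) *\<^sub>R g (x + y) = g ((1/2::real) *\<^sub>R x + (1/2::real) *\<^sub>R y)"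
      by (simp add: scale flip: scaleR_add_right)
    also have "\<dots> = (1/2::real) *\<^sub>R f x + (1/2::real) *\<^sub>R f y - f 0"
      using aff[of "1/2" x y] by (simp add: g_def)
    also have "\<dots> = (1/2::real) *\<^sub>R f x + (1/2::real) *\<^sub>R f y - ((1/2::real) + 1/2) *\<^sub>R f 0"
      by simp
    also have "\<dots> = (1/2::real) *\<^sub>R (g x + g y)"
      unfolding scaleR_left_distrib by (simp add: g_def algebra_simps)
    finally show ?thesis
      by (metis scaleR_left_imp_eq zero_neq_one divide_eq_0_iff zero_neq_numeral)
  qed
  then have "linear g"
    using scale by (rule linearI)
  then have "g (cesaro u N) = cesaro (\<lambda>k. g (u k)) N"
    by (simp add: cesaro_def linear_cmul linear_sum)
  also have "\<dots> = cesaro (\<lambda>k. f (u k)) N - cesaro (\<lambda>_. f 0) N"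
    by (simp only: cesaro_def g_def sum_subtractf scaleR_diff_right)
  finally show ?thesis
    by (simp add: g_def)
qed

text \<open>A shift by one changes the average only by \<open>u (N + 1) - u 0\<close> divided by
  \<open>N + 1\<close>, which tends to 0 by compactness.\<close>

lemma cesaro_shift_tendsto:
  fixes u :: "nat \<Rightarrow> 'v::topological_real_vector"
  assumes "compact K" "\<And>n. u n \<in> K" "G \<le> sequentially" "(cesaro u \<longlongrightarrow> x) G"
  shows "(cesaro (\<lambda>n. u (n + m)) \<longlongrightarrow> x) G"
proof (induction m)
  case 0
  then show ?case using assms(4) by simp
next
  case (Suc m)
  let ?v = "\<lambda>n. u (n + m)" and ?c = "\<lambda>N. inverse (real (Suc N))"
  have "cesaro (\<lambda>n. u (n + Suc m)) N = cesaro ?v N + (?c N *\<^sub>R ?v (Suc N) - ?c N *\<^sub>R ?v 0)" for N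
  proof -
    have "(\<Sum>k\<le>N. ?v (Suc k)) = (\<Sum>k\<le>N. ?v k) + ?v (Suc N) - ?v 0"
      using sum.atMost_Suc_shift[of ?v N] by (simp add: algebra_simps)
    then show ?thesis
      by (simp add: cesaro_def scaleR_add_right scaleR_diff_right)
  qed
  moreover have "((\<lambda>N. ?c N *\<^sub>R ?v (Suc N)) \<longlongrightarrow> 0) G" "((\<lambda>N. ?c N *\<^sub>R ?v 0) \<longlongrightarrow> 0) G"
    using compact_divide_Suc_tendsto_0[of K "\<lambda>N. ?v (Suc N)"]
      compact_divide_Suc_tendsto_0[of K "\<lambda>_. ?v 0"] assms(1-3)
    by (blast intro: tendsto_mono)+
  from tendsto_add[OF Suc.IH tendsto_diff[OF this]]
  have "((\<lambda>N. cesaro ?v N + (?c N *\<^sub>R ?v (Suc N) - ?c N *\<^sub>R ?v 0)) \<longlongrightarrow> x) G"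
    by simp
  ultimately show ?case by simp
qed

lemma convex_fixed_points: "affine_transformation f \<Longrightarrow> convex {x. f x = x}"
  by (simp add: affine_transformation_def convex_alt)

lemma tendsto_affine_cesaro:
  assumes "affine_transformation f" "continuous_on UNIV f" "(cesaro u \<longlongrightarrow> x) G"
  shows "(cesaro (\<lambda>n. f (u n)) \<longlongrightarrow> f x) G"
proof -
  have "((\<lambda>N. f (cesaro u N)) \<longlongrightarrow> f x) G"
    using assms(2,3) by (simp add: continuous_on_tendsto_compose)
  then show ?thesis
    by (simp add: affine_transformation_cesaro[OF assms(1)])
qed

section \<open>Fixed points of one affine map and of commuting families\<close>

lemma funpow_mem: "f ` K \<subseteq> K \<Longrightarrow> x \<in> K \<Longrightarrow> (f ^^ n) x \<in> K"
  by (induction n) auto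

text \<open>The images under \<open>f\<close> of the orbit averages are the averages of the shifted
  orbit. Along \<open>G\<close> they tend to \<open>f x\<close> by continuity and to
  \<open>x\<close> by \<open>cesaro_shift_tendsto\<close>, so the two agree in a Hausdorff space.
  Passing from a given \<open>F\<close> to a refinement \<open>G\<close> permits repeated use along
  decreasing filters.\<close>

lemma cesaro_orbit_limit:
  fixes f :: "'v::{topological_real_vector, t2_space} \<Rightarrow> 'v"
  assumes "convex K" "compact K" "affine_transformation f" "continuous_on UNIV f" "f ` K \<subseteq> K"
    and "y \<in> K" "F \<noteq> bot" "F \<le> sequentially"
  obtains x G where "x \<in> K" "f x = x" "G \<le> F" "G \<noteq> bot" "(cesaro (\<lambda>k. (f ^^ k) y) \<longlongrightarrow> x) G"
proof -
  let ?u = "\<lambda>k. (f ^^ k) y"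
  have mem: "?u k \<in> K" for k
    using assms(5,6) by (rule funpow_mem)
  obtain x G where G: "x \<in> K" "G \<le> F" "G \<noteq> bot" "(cesaro ?u \<longlongrightarrow> x) G"
    by (rule compact_refine_filter[OF assms(2,7), of "cesaro ?u"])
      (rule cesaro_mem[OF assms(1) mem])
  have "(cesaro (\<lambda>k. ?u (k + 1)) \<longlongrightarrow> x) G"
    using assms(2) mem order_trans[OF G(2) assms(8)] G(4) by (rule cesaro_shift_tendsto)
  moreover have "(cesaro (\<lambda>k. f (?u k)) \<longlongrightarrow> f x) G"
    using assms(3,4) G(4) by (rule tendsto_affine_cesaro)
  ultimately have "f x = x"
    using G(3) by (simp add: tendsto_unique)
  then show thesis using that G by blast
qed

text \<open>Finite subfamilies are treated one map at a time, each map acting on the common fixed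
  points of the previous ones. The finite intersection property of the closed fixed sets in the
  compact \<open>K\<close> then covers all of \<open>F\<close>.\<close>

theorem markov_kakutani:
  fixes K :: "'v::{topological_real_vector, t2_space} set"
  assumes "convex K" "compact K" "K \<noteq> {}"
    and F: "\<And>f. f \<in> F \<Longrightarrow> affine_transformation f" "\<And>f. f \<in> F \<Longrightarrow> continuous_on UNIV f"
      "\<And>f. f \<in> F \<Longrightarrow> f ` K \<subseteq> K"
    and comm: "\<And>f g x. f \<in> F \<Longrightarrow> g \<in> F \<Longrightarrow> x \<in> K \<Longrightarrow> f (g x) = g (f x)"
  obtains x where "x \<in> K" "\<And>f. f \<in> F \<Longrightarrow> f x = x"
proof -
  let ?Fix = "\<lambda>f::'v \<Rightarrow> 'v. {x. f x = x}"
  have closed: "closed (?Fix f)" if "f \<in> F" for f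
    using F(2)[OF that] by (intro closed_Collect_eq) auto
  have finite: "\<exists>x\<in>K. \<forall>f\<in>H. f x = x" if "finite H" "H \<subseteq> F" for H
    using that
  proof (induction H)
    case empty
    then show ?case using assms(3) by auto
  next
    case (insert f H)
    define L where "L = K \<inter> (\<Inter>g\<in>H. ?Fix g)"
    obtain y where "y \<in> L"
      using insert by (auto simp: L_def)
    have "convex (?Fix g)" if "g \<in> H" for g
      using F(1)[of g] that insert.prems by (intro convex_fixed_points) auto
    then have "convex L"
      unfolding L_def by (intro convex_Int assms convex_INT)
    moreover have "compact L"
      unfolding L_def using closed insert.prems by (intro compact_Int_closed assms closed_INT) auto
    moreover have "affine_transformation f" "continuous_on UNIV f"
      using F insert.prems by auto
    moreover have "f ` L \<subseteq> L"
    proof (rule image_subsetI)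
      fix x assume "x \<in> L"
      have "g (f x) = f x" if "g \<in> H" for g
      proof -
        have "g \<in> F" "f \<in> F" "x \<in> K" "g x = x"
          using that insert.prems \<open>x \<in> L\<close> by (auto simp: L_def)
        then show ?thesis using comm[of g f x] by simp
      qed
      with \<open>x \<in> L\<close> show "f x \<in> L"
        using F(3)[of f] insert.prems by (auto simp: L_def)
    qed
    ultimately obtain x where "x \<in> L" "f x = x"
      by (rule cesaro_orbit_limit[OF _ _ _ _ _ \<open>y \<in> L\<close> sequentially_bot order_refl])
    then show ?case by (auto simp: L_def)
  qed
  have "K \<inter> \<Inter> (?Fix ` F) \<noteq> {}"
  proof (rule compact_imp_fip[OF assms(2)])
    show "closed T" if "T \<in> ?Fix ` F" for T
      using that closed by auto
    show "K \<inter> \<Inter> B \<noteq> {}" if B: "finite B" "B \<subseteq> ?Fix ` F" for B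
    proof -
      obtain H where "H \<subseteq> F" "finite H" "B = ?Fix ` H"
        using finite_subset_image[OF B] by blast
      then show ?thesis using finite[of H] by auto
    qed
  qed
  then show thesis using that by auto
qed

section \<open>Amenability of commutative monoids and of semi-direct products\<close>

lemma amenable_comm_monoid:
  assumes "comm_monoid T"
  shows "amenable TYPE('v::{topological_real_vector, t2_space}) T"
  unfolding amenable_def
proof (intro allI impI)
  interpret comm_monoid T by fact
  fix \<alpha> :: "_ \<Rightarrow> 'v \<Rightarrow> 'v" and K :: "'v set"
  assume "convex_compact_space T \<alpha> K \<and> K \<noteq> {}"
  then have K: "convex K" "compact K" "K \<noteq> {}"
    and maps: "\<And>f. f \<in> \<alpha> ` carrier T \<Longrightarrow> affine_transformation f"
      "\<And>f. f \<in> \<alpha> ` carrier T \<Longrightarrow> continuous_on UNIV f"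
      "\<And>f. f \<in> \<alpha> ` carrier T \<Longrightarrow> f ` K \<subseteq> K"
    and mult: "\<And>g h x. g \<in> carrier T \<Longrightarrow> h \<in> carrier T \<Longrightarrow> \<alpha> (g \<otimes>\<^bsub>T\<^esub> h) x = \<alpha> g (\<alpha> h x)"
    unfolding convex_compact_space_def by (elim conjE, blast)+
  have "\<alpha> g (\<alpha> h x) = \<alpha> h (\<alpha> g x)" if "g \<in> carrier T" "h \<in> carrier T" for g h x
    using m_comm[OF that] mult that by metis
  then have "f (g x) = g (f x)" if "f \<in> \<alpha> ` carrier T" "g \<in> \<alpha> ` carrier T" for f g x
    using that by blast
  then obtain x where "x \<in> K" "\<And>f. f \<in> \<alpha> ` carrier T \<Longrightarrow> f x = x"
    using markov_kakutani[OF K maps] by metis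
  then show "\<exists>x\<in>K. \<forall>g\<in>carrier T. \<alpha> g x = x" by blast
qed

lemma amenable_right_semidirect:
  assumes "monoid S" "monoid T"
    and closed: "\<And>s t. s \<in> carrier S \<Longrightarrow> t \<in> carrier T \<Longrightarrow> act t s \<in> carrier T"
    and act_one: "\<And>t. t \<in> carrier T \<Longrightarrow> act t \<one>\<^bsub>S\<^esub> = t"
    and one_act: "\<And>s. s \<in> carrier S \<Longrightarrow> act \<one>\<^bsub>T\<^esub> s = \<one>\<^bsub>T\<^esub>"
    and S: "amenable TYPE('v::{topological_real_vector, t2_space}) S"
    and T: "amenable TYPE('v) T"
  shows "amenable TYPE('v) (right_semidirect S T act)"
  unfolding amenable_def
proof (intro allI impI)
  let ?M = "right_semidirect S T act"
  interpret S: monoid S by fact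
  interpret T: monoid T by fact
  fix \<alpha> :: "_ \<Rightarrow> 'v \<Rightarrow> 'v" and K :: "'v set"
  assume A: "convex_compact_space ?M \<alpha> K \<and> K \<noteq> {}"
  have car: "(s, t) \<in> carrier ?M" if "s \<in> carrier S" "t \<in> carrier T" for s t
    using that by (simp add: right_semidirect_def)
  have one: "\<alpha> (\<one>\<^bsub>S\<^esub>, \<one>\<^bsub>T\<^esub>) x = x" for x
    using A by (simp add: convex_compact_space_def right_semidirect_def)
  have mult: "\<alpha> (s, t) (\<alpha> (s', t') x) = \<alpha> (s \<otimes>\<^bsub>S\<^esub> s', act t s' \<otimes>\<^bsub>T\<^esub> t') x"
    if "s \<in> carrier S" "t \<in> carrier T" "s' \<in> carrier S" "t' \<in> carrier T" for s t s' t' x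
    using A that by (simp add: convex_compact_space_def right_semidirect_def)
  have maps: "affine_transformation (\<alpha> (s, t))" "continuous_on UNIV (\<alpha> (s, t))"
    "\<alpha> (s, t) ` K \<subseteq> K" if "s \<in> carrier S" "t \<in> carrier T" for s t
    using A car[OF that] by (auto simp: convex_compact_space_def)
  \<comment> \<open>\<open>T\<close> embeds as the pairs with first component one. Amenability of
    \<open>T\<close> makes \<open>L\<close> nonempty, and that of \<open>S\<close> is then applied
    on \<open>L\<close> instead of \<open>K\<close>.\<close>
  define L where "L = K \<inter> (\<Inter>t\<in>carrier T. {x. \<alpha> (\<one>\<^bsub>S\<^esub>, t) x = x})"
  have "convex_compact_space T (\<lambda>t. \<alpha> (\<one>\<^bsub>S\<^esub>, t)) K"
    using A maps unfolding convex_compact_space_def by (simp add: one mult act_one)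
  then have "L \<noteq> {}"
    using T A unfolding amenable_def L_def by blast
  moreover have "convex_compact_space S (\<lambda>s. \<alpha> (s, \<one>\<^bsub>T\<^esub>)) L"
    unfolding convex_compact_space_def
  proof (intro conjI ballI allI)
    have "convex {x. \<alpha> (\<one>\<^bsub>S\<^esub>, t) x = x}" if "t \<in> carrier T" for t
      using maps(1)[OF S.one_closed that] by (rule convex_fixed_points)
    with A show "convex L"
      unfolding L_def by (intro convex_Int convex_INT) (auto simp: convex_compact_space_def)
    show "compact L"
      unfolding L_def using A maps(2)
      by (intro compact_Int_closed closed_INT ballI closed_Collect_eq)
        (auto simp: convex_compact_space_def)
    fix s assume s: "s \<in> carrier S"
    show "\<alpha> (s, \<one>\<^bsub>T\<^esub>) ` L \<subseteq> L"
    proof (rule image_subsetI)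
      fix x assume x: "x \<in> L"
      have "\<alpha> (\<one>\<^bsub>S\<^esub>, t) (\<alpha> (s, \<one>\<^bsub>T\<^esub>) x) = \<alpha> (s, \<one>\<^bsub>T\<^esub>) x" if t: "t \<in> carrier T" for t
      proof -
        \<comment> \<open>Both \<open>(1, t)(s, 1)\<close> and \<open>(s, 1)(1, act t s)\<close>
          equal \<open>(s, act t s)\<close>.\<close>
        have "\<alpha> (\<one>\<^bsub>S\<^esub>, t) (\<alpha> (s, \<one>\<^bsub>T\<^esub>) x) = \<alpha> (s, \<one>\<^bsub>T\<^esub>) (\<alpha> (\<one>\<^bsub>S\<^esub>, act t s) x)"
          using s t by (simp add: mult closed act_one one_act)
        then show ?thesis
          using x closed[OF s t] by (simp add: L_def)
      qed
      then show "\<alpha> (s, \<one>\<^bsub>T\<^esub>) x \<in> L"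
        using x maps(3)[OF s T.one_closed] by (auto simp: L_def)
    qed
  qed (simp_all add: one mult one_act maps)
  ultimately obtain x where x: "x \<in> L" "\<And>s. s \<in> carrier S \<Longrightarrow> \<alpha> (s, \<one>\<^bsub>T\<^esub>) x = x"
    using S unfolding amenable_def by blast
  \<comment> \<open>\<open>(s, t)\<close> is the product \<open>(s, 1)(1, t)\<close>, and both
    factors fix \<open>x\<close>.\<close>
  have "\<alpha> (s, t) x = x" if "s \<in> carrier S" "t \<in> carrier T" for s t
    using mult[of s "\<one>\<^bsub>T\<^esub>" "\<one>\<^bsub>S\<^esub>" t x] x that by (simp add: L_def one_act)
  with x(1) show "\<exists>x\<in>K. \<forall>g\<in>carrier ?M. \<alpha> g x = x"
    by (auto simp: L_def right_semidirect_def)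
qed

section \<open>The fixed point for the facial monoid\<close>

lemma facial_relations_fixed_point:
  fixes \<sigma> :: "nat \<Rightarrow> 'v \<Rightarrow> 'v::{topological_real_vector, t2_space}"
  assumes K: "convex K" "compact K" "K \<noteq> {}"
    and \<sigma>: "\<And>i. affine_transformation (\<sigma> i)" "\<And>i. continuous_on UNIV (\<sigma> i)" "\<And>i. \<sigma> i ` K \<subseteq> K"
    and rel: "\<And>i j x. i \<le> j \<Longrightarrow> \<sigma> j (\<sigma> i x) = \<sigma> i (\<sigma> (Suc j) x)"
  obtains x where "x \<in> K" "\<And>i. \<sigma> i x = x"
proof -
  let ?orbit = "\<lambda>n y. cesaro (\<lambda>k. (\<sigma> n ^^ k) y)"
  define P where "P n = (\<lambda>(x, G). x \<in> K \<and> \<sigma> n x = x \<and> G \<noteq> bot \<and> G \<le> sequentially)" for n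
  \<comment> \<open>All averages must converge along a common refinement, so the filters are decreasing.\<close>
  define Q where "Q n = (\<lambda>(x, G) (x', G'). G' \<le> G \<and> (?orbit (Suc n) x \<longlongrightarrow> x') G')" for n :: nat
  have "\<exists>z. P 0 z"
  proof -
    obtain y where "y \<in> K" using K(3) by auto
    from K(1,2) \<sigma> this obtain x G
      where "x \<in> K" "\<sigma> 0 x = x" "G \<le> sequentially" "G \<noteq> bot"
      by (rule cesaro_orbit_limit[OF _ _ _ _ _ _ sequentially_bot order_refl])
    then have "P 0 (x, G)" by (simp add: P_def)
    then show ?thesis by blast
  qed
  moreover have "\<exists>z'. P (Suc n) z' \<and> Q n z z'" if z: "P n z" for n z
  proof -
    obtain x G where [simp]: "z = (x, G)" by (cases z)
    have "x \<in> K" "G \<noteq> bot" "G \<le> sequentially" using z by (auto simp: P_def)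
    from K(1,2) \<sigma> this obtain x' G'
      where "x' \<in> K" "\<sigma> (Suc n) x' = x'" "G' \<le> G" "G' \<noteq> bot"
      "(?orbit (Suc n) x \<longlongrightarrow> x') G'"
      by (rule cesaro_orbit_limit)
    with \<open>G \<le> sequentially\<close> have "P (Suc n) (x', G') \<and> Q n z (x', G')"
      by (auto simp: P_def Q_def)
    then show ?thesis by blast
  qed
  ultimately obtain z where z: "\<And>n. P n (z n)" "\<And>n. Q n (z n) (z (Suc n))"
    using dependent_nat_choice[of P Q] by metis
  define x where "x n = fst (z n)" for n
  define G where "G n = snd (z n)" for n
  have x: "x n \<in> K" "\<sigma> n (x n) = x n" "G n \<noteq> bot" for n
    using z(1)[of n] by (auto simp: P_def x_def G_def split: prod.splits)
  have G: "G (Suc n) \<le> G n" "(?orbit (Suc n) (x n) \<longlongrightarrow> x (Suc n)) (G (Suc n))" for n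
    using z(2)[of n] by (auto simp: Q_def x_def G_def split: prod.splits)
  \<comment> \<open>By \<open>rel\<close>, \<open>\<sigma> i\<close> intertwines
    \<open>\<sigma> (Suc n)\<close> with \<open>\<sigma> n\<close>, so it carries orbits of the
    former to orbits of the latter.\<close>
  have conj: "\<sigma> i ((\<sigma> (Suc n) ^^ k) y) = (\<sigma> n ^^ k) (\<sigma> i y)" if "i \<le> n" for i n k y
    by (induction k) (simp_all flip: rel[OF that])
  have lim: "(?orbit n (\<sigma> i (x n)) \<longlongrightarrow> \<sigma> i (x (Suc n))) (G (Suc n))" if "i \<le> n" for i n
    using tendsto_affine_cesaro[OF \<sigma>(1,2) G(2)[of n], of i] by (simp add: conj[OF that])
  \<comment> \<open>This is the case \<open>i = n\<close> of \<open>lim\<close>: as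
    \<open>\<sigma> n\<close> fixes \<open>x n\<close>, the averages there are constant.\<close>
  have diag: "\<sigma> n (x (Suc n)) = x n" for n
  proof -
    have "(\<sigma> n ^^ k) (x n) = x n" for k
      by (induction k) (simp_all add: x(2))
    then have "?orbit n (\<sigma> n (x n)) = (\<lambda>_. x n)"
      by (simp add: x(2) fun_eq_iff)
    then have "((\<lambda>_. x n) \<longlongrightarrow> \<sigma> n (x (Suc n))) (G (Suc n))"
      using lim[of n n] by simp
    then show ?thesis
      using tendsto_unique[OF x(3) _ tendsto_const] by blast
  qed
  have shift: "\<sigma> i (x (Suc n)) = x n" if "i \<le> n" for i n
    using that
  proof (induction n)
    case 0
    then show ?case using diag by simp
  next
    case (Suc n)
    show ?case
    proof (cases "i = Suc n")
      case True
      then show ?thesis using diag by simp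
    next
      case False
      with Suc have "\<sigma> i (x (Suc n)) = x n" by simp
      \<comment> \<open>By the induction hypothesis, \<open>lim\<close> now concerns the
        \<open>\<sigma> (Suc n)\<close>-orbit of \<open>x n\<close>, whose averages tend to
        \<open>x (Suc n)\<close> by construction. Comparing the limits requires one common filter,
        which the refinement \<open>G (Suc (Suc n))\<close> provides.\<close>
      then have "(?orbit (Suc n) (x n) \<longlongrightarrow> \<sigma> i (x (Suc (Suc n)))) (G (Suc (Suc n)))"
        using lim[OF Suc.prems] by simp
      moreover have "(?orbit (Suc n) (x n) \<longlongrightarrow> x (Suc n)) (G (Suc (Suc n)))"
        using G by (rule tendsto_mono)
      ultimately show ?thesis
        using tendsto_unique[OF x(3)] by blast
    qed
  qed
  obtain y H where H: "y \<in> K" "H \<le> sequentially" "H \<noteq> bot" "(cesaro x \<longlongrightarrow> y) H"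
    by (rule compact_refine_filter[OF K(2) sequentially_bot, of "cesaro x"])
      (rule cesaro_mem[OF K(1) x(1)])
  have "\<sigma> i y = y" for i
  proof -
    have lim: "(cesaro (\<lambda>n. x (n + m)) \<longlongrightarrow> y) H" for m
      using K(2) x(1) H(2,4) by (rule cesaro_shift_tendsto)
    \<comment> \<open>The index \<open>n + Suc i\<close> is the successor of \<open>n + i\<close>,
      and \<open>i \<le> n + i\<close>, so \<open>shift\<close> applies to every term.\<close>
    have "(cesaro (\<lambda>n. \<sigma> i (x (n + Suc i))) \<longlongrightarrow> \<sigma> i y) H"
      using \<sigma>(1,2) lim by (rule tendsto_affine_cesaro)
    then have "(cesaro (\<lambda>n. x (n + i)) \<longlongrightarrow> \<sigma> i y) H"
      by (simp add: shift)
    then show ?thesis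
      using lim[of i] H(3) by (simp add: tendsto_unique)
  qed
  with H(1) show thesis using that by blast
qed

lemma amenable_facial_monoid:
  "amenable TYPE('v::{topological_real_vector, t2_space}) facial_monoid"
  unfolding amenable_def
proof (intro allI impI)
  fix \<alpha> :: "_ \<Rightarrow> 'v \<Rightarrow> 'v" and K :: "'v set"
  assume A: "convex_compact_space facial_monoid \<alpha> K \<and> K \<noteq> {}"
  have car: "facial_class w \<in> carrier facial_monoid" if "w \<in> lists posnats" for w
    using that unfolding facial_monoid_def presented_monoid_def facial_class_def
    by (simp add: quotientI)
  have mult: "\<alpha> (facial_class v) (\<alpha> (facial_class w) x) = \<alpha> (facial_class (v @ w)) x"
    if "v \<in> lists posnats" "w \<in> lists posnats" for v w x
    using A car that by (simp add: convex_compact_space_def flip: facial_class_mult)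
  \<comment> \<open>Generators are numbered from 1, whereas
    \<open>facial_relations_fixed_point\<close> counts from 0; the relations keep their form under
    this renumbering.\<close>
  let ?\<sigma> = "\<lambda>i. \<alpha> (facial_class [Suc i])"
  have maps: "affine_transformation (?\<sigma> i)" "continuous_on UNIV (?\<sigma> i)" "?\<sigma> i ` K \<subseteq> K" for i
    using A car[of "[Suc i]"] by (auto simp: convex_compact_space_def)
  have rel: "?\<sigma> j (?\<sigma> i x) = ?\<sigma> i (?\<sigma> (Suc j) x)" if "i \<le> j" for i j x
  proof -
    have "facial_class [Suc j, Suc i] = facial_class [Suc i, Suc (Suc j)]"
      using facial_generators_relation[of "Suc i" "Suc j"] that by (simp add: facial_class_mult)
    then show ?thesis by (simp add: mult)
  qed
  have "convex K" "compact K" "K \<noteq> {}"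
    using A by (auto simp: convex_compact_space_def)
  then obtain x where x: "x \<in> K" "\<And>i. ?\<sigma> i x = x"
    using facial_relations_fixed_point[of K ?\<sigma>] maps rel by metis
  have "\<alpha> (facial_class w) x = x" if "w \<in> lists posnats" for w
    using that
  proof (induction w)
    case Nil
    have "facial_class [] = \<one>\<^bsub>facial_monoid\<^esub>"
      by (simp add: facial_class_def facial_monoid_def presented_monoid_def)
    then show ?case using A by (simp add: convex_compact_space_def)
  next
    case (Cons i w)
    then have "\<alpha> (facial_class (i # w)) x = \<alpha> (facial_class [i]) x"
      using mult[of "[i]" w x] by simp
    \<comment> \<open>Letters are at least 1, so \<open>Suc (i - 1)\<close> is
      \<open>i\<close>.\<close>
    then show ?case
      using x(2)[of "i - 1"] Cons.hyps by simp
  qed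
  with x(1) show "\<exists>x\<in>K. \<forall>g\<in>carrier facial_monoid. \<alpha> g x = x"
    by (metis facial_carrierE)
qed

theorem corollary5p4:
  shows "amenable TYPE('v::{topological_real_vector, t2_space})
      (right_semidirect facial_monoid (free_abelian_monoid posnats) facial_act)
    \<and> amenable TYPE('v::{topological_real_vector, t2_space})
      (right_semidirect facial_monoid (free_Abelian_group posnats) facial_act)"
proof -
  have S: "monoid facial_monoid"
    unfolding facial_monoid_def by (rule monoid_presented_monoid)
  have N: "comm_monoid (free_abelian_monoid posnats)"
    using monoid_free_abelian_monoid
    by (rule monoid.monoid_comm_monoidI) (simp add: free_abelian_monoid_def add.commute)
  have Z: "comm_monoid (free_Abelian_group posnats)"
    using abelian_free_Abelian_group by (rule comm_group.axioms(1))
  have one: "\<one>\<^bsub>free_abelian_monoid posnats\<^esub> = 0"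
    by (simp add: free_abelian_monoid_def)
  show ?thesis
    using N Z facial_act_closed
    by (intro conjI amenable_right_semidirect S amenable_facial_monoid amenable_comm_monoid)
      (auto simp: one facial_act_one facial_act_zero comm_monoid.axioms(1)
        simp del: carrier_free_Abelian_group_iff)
qed

end
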